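(* Let $A(r)$, $r\ge 0$, denote the $r$-level complete Apollonian network, and let $sg(G)$ denote the strong geodetic number of a graph $G$. Then $sg(A(0)) = sg(A(1)) = 4$, and $sg(A(k)) = 3^k$ for every integer $k\ge 2$.
   Context: Strong geodetic number: Let $G=(V,E)$ be a finite simple connected graph. A geodesic between $x$ and $y$ is a shortest $x,y$-path. For $S\subseteq V$, choose for each unordered pair of distinct vertices $x,y\in S$ exactly one fixed shortest $x,y$-path $\widetilde{g}(x,y)$, and let $\widetilde{I}(S)=\{\widetilde{g}(x,y) : x,y\in S,\ x\ne y\}$ be the resulting collection of $|S|(|S|-1)/2$ geodesics. Let $V(\widetilde{I}(S))=\bigcup_{P\in\widetilde{I}(S)}V(P)$ be the set of vertices lying on these geodesics. The set $S$ is a strong geodetic set of $G$ if there is some choice of $\widetilde{I}(S)$ for which $V(\widetilde{I}(S))=V$. The strong geodetic number $sg(G)$ is the minimum cardinality of a strong geodetic set of $G$. Complete Apollonian networks: Start from a single triangle with vertices $a,b,c$ drawn in the plane. Add a new vertex $(0,0)$ (the $0$-level vertex) inside the triangle and join it to $a$, $b$ and $c$; the resulting plane graph is $A(0)$, which is isomorphic to $K_4$. For $r\ge 1$, the plane graph $A(r)$ is obtained from the plane graph $A(r-1)$ by adding, inside each inner (bounded) triangular face with vertices $x,y,z$ of $A(r-1)$, one new vertex (an $r$-level vertex) and joining it to $x$, $y$ and $z$. The outer face $abc$ is never filled. Thus $A(r)$ has exactly $3^r$ $r$-level vertices. *)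

theory Defs
  imports "Graph_Theory.Graph_Theory"
begin

text \<open>
  A finite simple graph is a \<open>pair_graph\<close>: a finite, loop-free, symmetric set of pairs. A path is
  the list of its vertices, so that an undirected path is represented by a list and by its reversal.
\<close>

definition geodesic :: "'a pair_pre_digraph \<Rightarrow> 'a \<Rightarrow> 'a \<Rightarrow> 'a list \<Rightarrow> bool" where
  "geodesic G x y p \<longleftrightarrow>
     vpath p (with_proj G) \<and> hd p = x \<and> last p = y \<and>
     (\<forall>q. vpath q (with_proj G) \<and> hd q = x \<and> last q = y \<longrightarrow> vwalk_length p \<le> vwalk_length q)"

text \<open>
  The condition \<open>g y x = rev (g x y)\<close> says that only one geodesic is chosen for each unordered pair.
\<close>

definition geodesic_choice ::
    "'a pair_pre_digraph \<Rightarrow> 'a set \<Rightarrow> ('a \<Rightarrow> 'a \<Rightarrow> 'a list) \<Rightarrow> bool" where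
  "geodesic_choice G S g \<longleftrightarrow>
     (\<forall>x\<in>S. \<forall>y\<in>S. x \<noteq> y \<longrightarrow> geodesic G x y (g x y) \<and> g y x = rev (g x y))"

definition strong_geodetic_set :: "'a pair_pre_digraph \<Rightarrow> 'a set \<Rightarrow> bool" where
  "strong_geodetic_set G S \<longleftrightarrow>
     S \<subseteq> pverts G \<and>
     (\<exists>g. geodesic_choice G S g \<and> (\<Union>x\<in>S. \<Union>y\<in>S - {x}. set (g x y)) = pverts G)"

definition sg :: "'a pair_pre_digraph \<Rightarrow> nat" where
  "sg G = (LEAST n. \<exists>S. strong_geodetic_set G S \<and> card S = n)"

text \<open>
  A plane triangulation is represented by its graph and the set of its inner faces, each inner face
  being given by one fixed ordering of its three corners. The vertex added inside the face
  \<open>(x, y, z)\<close> is named \<open>Centre x y z\<close>, so that different faces receive different new vertices.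
\<close>

datatype apollonian_vertex =
  CornerA | CornerB | CornerC
  | Centre apollonian_vertex apollonian_vertex apollonian_vertex

type_synonym face = "apollonian_vertex \<times> apollonian_vertex \<times> apollonian_vertex"

fun centre :: "face \<Rightarrow> apollonian_vertex" where
  "centre (x, y, z) = Centre x y z"

fun corners :: "face \<Rightarrow> apollonian_vertex set" where
  "corners (x, y, z) = {x, y, z}"

text \<open>The three faces into which a face is divided by its new vertex.\<close>

fun subfaces :: "face \<Rightarrow> face set" where
  "subfaces (x, y, z) = {(Centre x y z, x, y), (Centre x y z, y, z), (Centre x y z, x, z)}"

record plane_triangulation =
  tri_graph :: "apollonian_vertex pair_pre_digraph"
  inner_faces :: "face set"

definition base_triangle :: plane_triangulation where
  "base_triangle =
    \<lparr> tri_graph =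
        \<lparr> pverts = {CornerA, CornerB, CornerC},
          parcs = {(u, v). u \<in> {CornerA, CornerB, CornerC} \<and> v \<in> {CornerA, CornerB, CornerC} \<and> u \<noteq> v} \<rparr>,
      inner_faces = {(CornerA, CornerB, CornerC)} \<rparr>"

definition fill_inner_faces :: "plane_triangulation \<Rightarrow> plane_triangulation" where
  "fill_inner_faces T =
    \<lparr> tri_graph =
        \<lparr> pverts = pverts (tri_graph T) \<union> centre ` inner_faces T,
          parcs = parcs (tri_graph T)
            \<union> {(centre f, u) | f u. f \<in> inner_faces T \<and> u \<in> corners f}
            \<union> {(u, centre f) | f u. f \<in> inner_faces T \<and> u \<in> corners f} \<rparr>,
      inner_faces = (\<Union>f\<in>inner_faces T. subfaces f) \<rparr>"

primrec apollonian_plane :: "nat \<Rightarrow> plane_triangulation" where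
  "apollonian_plane 0 = fill_inner_faces base_triangle"
| "apollonian_plane (Suc r) = fill_inner_faces (apollonian_plane r)"

definition apollonian :: "nat \<Rightarrow> apollonian_vertex pair_pre_digraph" where
  "apollonian r = tri_graph (apollonian_plane r)"

text \<open>
  The representation has the expected properties: the networks are connected finite simple graphs,
  all names of added vertices are fresh, and \<open>3 ^ r\<close> vertices are added at level \<open>r\<close>.
\<close>

fun depth :: "apollonian_vertex \<Rightarrow> nat" where
  "depth (Centre x y z) = Suc (max (depth x) (max (depth y) (depth z)))"
| "depth _ = 0"

definition good_triangulation :: "nat \<Rightarrow> plane_triangulation \<Rightarrow> bool" where
  "good_triangulation n T \<longleftrightarrow>
     pair_graph (tri_graph T) \<and> strongly_connected (with_proj (tri_graph T)) \<and>
     finite (inner_faces T) \<and> card (inner_faces T) = 3 ^ n \<and>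
     (\<forall>v\<in>pverts (tri_graph T). depth v \<le> n) \<and>
     (\<forall>f\<in>inner_faces T. corners f \<subseteq> pverts (tri_graph T) \<and> depth (centre f) = Suc n \<and>
        (case f of (x, y, z) \<Rightarrow> x \<noteq> y \<and> y \<noteq> z \<and> x \<noteq> z))"

lemma inj_centre: "inj centre"
  by (auto simp: inj_def)

lemma good_triangle: "good_triangulation 0 base_triangle"
proof -
  let ?G = "tri_graph base_triangle"
  have fin: "finite (parcs ?G)"
    by (rule finite_subset[of _ "{CornerA, CornerB, CornerC} \<times> {CornerA, CornerB, CornerC}"])
       (auto simp: base_triangle_def)
  have pg: "pair_graph ?G"
    using fin by unfold_locales (auto simp: base_triangle_def symmetric_def sym_def)
  then interpret pair_graph ?G .
  have "u \<rightarrow>\<^sup>*\<^bsub>with_proj ?G\<^esub> v" if "u \<in> pverts ?G" "v \<in> pverts ?G" for u v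
  proof (cases "u = v")
    case True
    then show ?thesis using that by simp
  next
    case False
    then have "(u, v) \<in> parcs ?G" using that by (auto simp: base_triangle_def)
    then show ?thesis by (simp add: reachable_adjI)
  qed
  then have "strongly_connected (with_proj ?G)"
    by (intro strongly_connectedI) (auto simp: base_triangle_def)
  with pg show ?thesis
    by (auto simp: good_triangulation_def base_triangle_def)
qed

lemma good_fill:
  assumes "good_triangulation n T"
  shows "good_triangulation (Suc n) (fill_inner_faces T)"
proof -
  let ?G = "tri_graph T" and ?H = "tri_graph (fill_inner_faces T)"
  from assms have pg: "pair_graph ?G" and sc: "strongly_connected (with_proj ?G)"
    and fin: "finite (inner_faces T)" and crd: "card (inner_faces T) = 3 ^ n"
    and dep: "\<And>v. v \<in> pverts ?G \<Longrightarrow> depth v \<le> n"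
    and cor: "\<And>f. f \<in> inner_faces T \<Longrightarrow> corners f \<subseteq> pverts ?G"
    and dc: "\<And>f. f \<in> inner_faces T \<Longrightarrow> depth (centre f) = Suc n"
    and dist: "\<And>x y z. (x, y, z) \<in> inner_faces T \<Longrightarrow> x \<noteq> y \<and> y \<noteq> z \<and> x \<noteq> z"
    unfolding good_triangulation_def by (auto 0 3)
  interpret G: pair_graph ?G by (rule pg)
  have fresh: "centre f \<notin> pverts ?G" if "f \<in> inner_faces T" for f
    using dep dc that by fastforce
  have vH: "pverts ?H = pverts ?G \<union> centre ` inner_faces T"
    and aH: "parcs ?H = parcs ?G
      \<union> {(centre f, u) | f u. f \<in> inner_faces T \<and> u \<in> corners f}
      \<union> {(u, centre f) | f u. f \<in> inner_faces T \<and> u \<in> corners f}"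
    and fH: "inner_faces (fill_inner_faces T) = (\<Union>f\<in>inner_faces T. subfaces f)"
    by (simp_all add: fill_inner_faces_def)
  have finV: "finite (pverts ?H)"
    using fin G.pair_finite_verts by (simp add: vH)
  have wf: "parcs ?H \<subseteq> pverts ?H \<times> pverts ?H"
  proof
    fix e assume "e \<in> parcs ?H"
    then consider "e \<in> parcs ?G" | f u where "f \<in> inner_faces T" "u \<in> corners f"
        "e = (centre f, u) \<or> e = (u, centre f)"
      unfolding aH by blast
    then show "e \<in> pverts ?H \<times> pverts ?H"
    proof cases
      case 1
      then show ?thesis using G.in_arcsD1 G.in_arcsD2 by (cases e) (auto simp: vH)
    next
      case 2
      then show ?thesis using cor[of f] by (auto simp: vH)
    qed
  qed
  have loop: "fst e \<noteq> snd e" if "e \<in> parcs ?H" for e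
  proof -
    from that consider "e \<in> parcs ?G" | f u where "f \<in> inner_faces T" "u \<in> corners f"
        "e = (centre f, u) \<or> e = (u, centre f)"
      unfolding aH by blast
    then show ?thesis
    proof cases
      case 1
      then show ?thesis by (rule G.pair_no_loops)
    next
      case 2
      then have "u \<noteq> centre f" using fresh cor by blast
      then show ?thesis using 2 by auto
    qed
  qed
  have "sym (parcs ?G)"
    using G.pair_sym_arcs by (simp add: symmetric_def)
  then have sym: "sym (parcs ?H)"
    unfolding aH sym_def by blast
  have pgH: "pair_graph ?H"
    using wf loop sym finV finite_subset[OF wf]
    by unfold_locales (auto simp: symmetric_def)
  then interpret H: pair_graph ?H .
  have mono: "u \<rightarrow>\<^sup>*\<^bsub>with_proj ?H\<^esub> v" if "u \<in> pverts ?G" "v \<in> pverts ?G" for u v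
  proof -
    have "u \<rightarrow>\<^sup>*\<^bsub>with_proj ?G\<^esub> v" using sc that by (auto simp: strongly_connected_def)
    moreover have "subgraph (with_proj ?G) (with_proj ?H)"
      using G.wf_digraph_axioms H.wf_digraph_axioms
      by (auto simp: subgraph_def compatible_def vH aH wf_digraph_wp_iff)
    ultimately show ?thesis by (rule H.reachable_mono)
  qed
  have corner: "\<exists>u\<in>pverts ?G. w \<rightarrow>\<^sup>*\<^bsub>with_proj ?H\<^esub> u \<and> u \<rightarrow>\<^sup>*\<^bsub>with_proj ?H\<^esub> w" if "w \<in> pverts ?H" for w
  proof (cases "w \<in> pverts ?G")
    case True
    then show ?thesis using mono by blast
  next
    case False
    then obtain f where f: "f \<in> inner_faces T" "w = centre f" using \<open>w \<in> pverts ?H\<close> vH by auto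
    obtain u where u: "u \<in> corners f" by (cases f) auto
    have "(w, u) \<in> parcs ?H" "(u, w) \<in> parcs ?H" unfolding aH using f u by blast+
    moreover have "u \<in> pverts ?G" using cor f u by blast
    ultimately show ?thesis using f by (auto intro!: bexI[of _ u] H.reachable_adjI)
  qed
  have scH: "strongly_connected (with_proj ?H)"
  proof (rule strongly_connectedI)
    show "verts (with_proj ?H) \<noteq> {}" using sc by (auto simp: strongly_connected_def vH)
    fix u v assume "u \<in> verts (with_proj ?H)" "v \<in> verts (with_proj ?H)"
    then obtain u' v' where "u' \<in> pverts ?G" "v' \<in> pverts ?G"
      "u \<rightarrow>\<^sup>*\<^bsub>with_proj ?H\<^esub> u'" "v' \<rightarrow>\<^sup>*\<^bsub>with_proj ?H\<^esub> v"
      using corner by (metis with_proj_simps(1))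
    then show "u \<rightarrow>\<^sup>*\<^bsub>with_proj ?H\<^esub> v" using mono H.reachable_trans by metis
  qed
  have card3: "card (subfaces f) = 3" if "f \<in> inner_faces T" for f
    using dist that by (cases f) (auto simp: card_insert_if)
  have disj: "subfaces f \<inter> subfaces g = {}" if "f \<noteq> g" for f g
    using that by (cases f; cases g) auto
  have finS: "finite (subfaces f)" for f by (cases f) auto
  have "card (\<Union>f\<in>inner_faces T. subfaces f) = (\<Sum>f\<in>inner_faces T. card (subfaces f))"
    using fin finS disj by (intro card_UN_disjoint) auto
  then have crdH: "card (\<Union>f\<in>inner_faces T. subfaces f) = 3 ^ Suc n"
    using card3 crd by simp
  have depH: "depth v \<le> Suc n" if "v \<in> pverts ?H" for v
    using that dep dc by (fastforce simp: vH)
  have faceH: "corners g \<subseteq> pverts ?H \<and> depth (centre g) = Suc (Suc n) \<and>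
      (case g of (x, y, z) \<Rightarrow> x \<noteq> y \<and> y \<noteq> z \<and> x \<noteq> z)"
    if fg: "f \<in> inner_faces T" "g \<in> subfaces f" for f g
  proof -
    obtain x y z where f: "f = (x, y, z)" by (cases f)
    have c: "x \<in> pverts ?G" "y \<in> pverts ?G" "z \<in> pverts ?G" using cor[OF fg(1)] f by auto
    have "Centre x y z \<notin> pverts ?G" "Centre x y z \<in> pverts ?H"
      using fresh[OF fg(1)] fg(1) f by (force simp: vH)+
    moreover have cH: "x \<in> pverts ?H" "y \<in> pverts ?H" "z \<in> pverts ?H"
      using c by (simp_all add: vH)
    moreover have "depth (Centre x y z) = Suc n" using dc[OF fg(1)] f by simp
    moreover have "depth x \<le> n" "depth y \<le> n" "depth z \<le> n" using c dep by auto
    ultimately show ?thesis using fg(2) f c dist[of x y z] fg(1)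
      by (auto simp: cH simp del: depth.simps(1) simp add: depth.simps(1)[of "Centre x y z"])
  qed
  show ?thesis
    unfolding good_triangulation_def fH
    using pgH scH fin finS crdH depH faceH by blast
qed

lemma good_apollonian_plane: "good_triangulation (Suc r) (apollonian_plane r)"
  by (induction r) (simp_all add: good_triangle good_fill)

lemma pair_graph_apollonian: "pair_graph (apollonian r)"
  and connected_apollonian: "strongly_connected (with_proj (apollonian r))"
  using good_apollonian_plane[of r] by (simp_all add: good_triangulation_def apollonian_def)

lemma card_new_vertices:
  "card (pverts (apollonian (Suc r)) - pverts (apollonian r)) = 3 ^ Suc r"
proof -
  have "good_triangulation (Suc r) (apollonian_plane r)" by (rule good_apollonian_plane)
  then have *: "card (inner_faces (apollonian_plane r)) = 3 ^ Suc r"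
    "\<forall>f\<in>inner_faces (apollonian_plane r). centre f \<notin> pverts (apollonian r)"
    unfolding good_triangulation_def apollonian_def by fastforce+
  then have "pverts (apollonian (Suc r)) - pverts (apollonian r) = centre ` inner_faces (apollonian_plane r)"
    by (auto simp: apollonian_def fill_inner_faces_def)
  then show ?thesis
    using * card_image[OF inj_on_subset[OF inj_centre subset_UNIV]] by metis
qed

end

theory Submission
  imports Defs
begin

text \<open>
  Call the level-\<open>k\<close> vertices of \<open>A(k)\<close> its leaves. A leaf is adjacent exactly to the three corners of
  the face in which it was placed, and these corners are pairwise adjacent: a leaf is simplicial. A
  shortest path has no simplicial vertex in its interior, so every strong geodetic set
  contains all \<open>3 ^ k\<close> leaves (\<open>simplicial_in_strong_geodetic_set\<close>, \<open>leaves_simplicial\<close>).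

  For \<open>k \<ge> 2\<close> the leaves suffice. Two leaves are never adjacent, so a common neighbour \<open>v\<close> of two leaves
  lies on a geodesic between them; it is enough to give every other vertex \<open>v\<close> its own pair of
  leaves adjacent to \<open>v\<close> (\<open>strong_geodetic_set_by_reserved_pairs\<close>). The pairs are kept apart by the
  tree of nested faces. Each \<open>v\<close> receives two sibling faces that both have \<open>v\<close> as a corner, and
  different vertices receive different pairs of siblings. Inside each of the two faces there is a
  leaf adjacent to \<open>v\<close>, because one of the faces into which a face is divided keeps any given
  corner. The two leaves determine the siblings, which are the two branches by which
  they leave their smallest common ancestor (\<open>siblings_determined_by_descendants\<close>). So only sibling
  pairs have to be distributed (\<open>strong_geodetic_set_by_sibling_faces\<close>). A face offers three of them and
  its own centre takes one. The outer triangle has room for two of its corners beside its centre;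
  the third corner needs a face one level below, which exists as soon as \<open>k \<ge> 2\<close>.

  In \<open>A(1)\<close> there is no such room, but adding the central vertex to the leaves releases the pair that
  it would have used; and three leaves alone cannot cover seven vertices. \<open>A(0)\<close> is complete, hence
  all of its vertices are simplicial.
\<close>

section \<open>Geodesics and simplicial vertices\<close>

lemma geodesic_rev:
  assumes "pair_graph G" "geodesic G x y p"
  shows "geodesic G y x (rev p)"
proof -
  interpret pair_graph G by fact
  have sym: "sym (parcs G)" using pair_sym_arcs by (simp add: symmetric_def)
  have rev: "vpath (rev q) (with_proj G) \<and> hd (rev q) = last q \<and> last (rev q) = hd q"
    if "vpath q (with_proj G)" for q
    using that symD[OF sym]
    by (auto simp: vpath_def vwalk_def set_vwalk_arcs_rev hd_rev last_rev)
  show ?thesis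
    unfolding geodesic_def
  proof (intro conjI allI impI)
    fix q assume q: "vpath q (with_proj G) \<and> hd q = y \<and> last q = x"
    moreover have "\<forall>q. vpath q (with_proj G) \<and> hd q = x \<and> last q = y \<longrightarrow> vwalk_length p \<le> vwalk_length q"
      using assms(2) unfolding geodesic_def by (elim conjE)
    ultimately have "vwalk_length p \<le> vwalk_length (rev q)"
      using rev[of q] by (simp del: vwalk_length_simp)
    then show "vwalk_length (rev p) \<le> vwalk_length q" by simp
  qed (use assms(2) rev[of p] in \<open>auto simp: geodesic_def\<close>)
qed

lemma geodesic_exists:
  assumes "pair_graph G" "strongly_connected (with_proj G)" "x \<in> pverts G" "y \<in> pverts G"
  shows "\<exists>p. geodesic G x y p"
proof -
  interpret pair_graph G by fact
  let ?P = "\<lambda>p. vpath p (with_proj G) \<and> hd p = x \<and> last p = y"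
  have "x \<rightarrow>\<^sup>*\<^bsub>with_proj G\<^esub> y" using assms by (auto simp: strongly_connected_def)
  then obtain p where "?P p" using reachable_vpath_conv by blast
  then obtain p where "?P p" "\<And>q. ?P q \<Longrightarrow> vwalk_length p \<le> vwalk_length q"
    using ex_has_least_nat[of ?P p vwalk_length] by blast
  then show ?thesis unfolding geodesic_def by blast
qed

lemma geodesic_through_common_neighbour:
  assumes "pair_graph G" "x \<noteq> y" "(x, y) \<notin> parcs G" "(x, v) \<in> parcs G" "(v, y) \<in> parcs G"
  shows "geodesic G x y [x, v, y]"
proof -
  interpret pair_graph G by fact
  have ends: "x \<in> pverts G" "v \<in> pverts G" "y \<in> pverts G" "x \<noteq> v" "v \<noteq> y"
    using assms in_arcsD1 in_arcsD2 pair_no_loops by fastforce+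
  have two: "2 \<le> vwalk_length q" if q: "vpath q (with_proj G)" "hd q = x" "last q = y" for q
  proof -
    consider "q = []" | u where "q = [u]" | u w where "q = [u, w]" | u w z r where "q = u # w # z # r"
      by (metis list.exhaust)
    then show ?thesis using q assms(2,3) by cases (auto simp: vpath_def vwalk_def)
  qed
  have "vpath [x, v, y] (with_proj G)"
    using ends assms by (auto simp: vpath_def vwalk_def)
  moreover have "vwalk_length [x, v, y] = 2" by simp
  ultimately show ?thesis
    unfolding geodesic_def using two by (auto simp del: vwalk_length_simp)
qed

text \<open>
  A common neighbour \<open>v\<close> bounds the length by two, so that at most one vertex \<open>m\<close>, not necessarily \<open>v\<close>,
  lies between the ends.
\<close>

lemma geodesic_length_two:
  assumes "pair_graph G" "geodesic G x y p" "(x, v) \<in> parcs G" "(v, y) \<in> parcs G" "x \<noteq> y"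
  shows "\<exists>m. set p \<subseteq> {x, m, y}"
proof -
  interpret pair_graph G by fact
  have "x \<in> pverts G" "v \<in> pverts G" "y \<in> pverts G" "x \<noteq> v" "v \<noteq> y"
    using assms in_arcsD1 in_arcsD2 pair_no_loops by fastforce+
  then have "vpath [x, v, y] (with_proj G)"
    using assms by (auto simp: vpath_def vwalk_def)
  then have "vwalk_length p \<le> vwalk_length [x, v, y]"
    using assms(2) unfolding geodesic_def by (auto simp del: vwalk_length_simp)
  then have len: "length p \<le> 3" by simp
  have p: "p \<noteq> []" "hd p = x" "last p = y"
    using assms(2) by (auto simp: geodesic_def vpath_def vwalk_def)
  consider u where "p = [u]" | u w where "p = [u, w]" | u w z where "p = [u, w, z]"
  proof -
    have "length p = 1 \<or> length p = 2 \<or> length p = 3"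
      using len p(1) length_0_conv[of p] by linarith
    then show thesis using that
      by (auto simp: length_Suc_conv numeral_2_eq_2 numeral_3_eq_3)
  qed
  then show ?thesis using p by cases auto
qed

definition simplicial :: "'a pair_pre_digraph \<Rightarrow> 'a \<Rightarrow> bool" where
  "simplicial G v \<longleftrightarrow> v \<in> pverts G \<and>
     (\<forall>u w. (u, v) \<in> parcs G \<and> (v, w) \<in> parcs G \<and> u \<noteq> w \<longrightarrow> (u, w) \<in> parcs G)"

text \<open>
  A path that passes through a simplicial vertex can skip it, since the vertices before and after
  it are adjacent. So a geodesic meets a simplicial vertex only at its ends.
\<close>

lemma simplicial_on_geodesic:
  assumes "geodesic G x y p" "simplicial G v" "v \<in> set p"
  shows "v = x \<or> v = y"
proof (rule ccontr)
  assume neq: "\<not> (v = x \<or> v = y)"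
  have p: "vpath p (with_proj G)" "hd p = x" "last p = y"
    and min: "\<And>q. vpath q (with_proj G) \<Longrightarrow> hd q = x \<Longrightarrow> last q = y \<Longrightarrow> vwalk_length p \<le> vwalk_length q"
    using assms(1) by (auto simp: geodesic_def)
  obtain xs ys where split: "p = xs @ v # ys" using assms(3) by (meson split_list)
  have ne: "xs \<noteq> []" "ys \<noteq> []" using neq p split by auto
  have arcs: "set (vwalk_arcs p) \<subseteq> parcs G" and dist: "distinct p" and verts: "set p \<subseteq> pverts G"
    using p(1) by (auto simp: vpath_def vwalk_def)
  have "(last xs, v) \<in> parcs G" "(v, hd ys) \<in> parcs G"
    using arcs ne split by (auto simp: vwalk_arcs_append)
  moreover have "last xs \<noteq> hd ys"
  proof -
    have "last xs \<in> set xs" "hd ys \<in> set ys" using ne by auto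
    then show ?thesis using dist split by auto
  qed
  ultimately have "(last xs, hd ys) \<in> parcs G" using assms(2) unfolding simplicial_def by blast
  then have "vpath (xs @ ys) (with_proj G)"
    using arcs dist verts ne split by (auto simp: vpath_def vwalk_def vwalk_arcs_append)
  moreover have "hd (xs @ ys) = x" "last (xs @ ys) = y" using p ne split by auto
  ultimately have "vwalk_length p \<le> vwalk_length (xs @ ys)" by (rule min)
  then show False using split ne by (cases xs) auto
qed

lemma simplicial_in_strong_geodetic_set:
  assumes "strong_geodetic_set G S" "simplicial G v"
  shows "v \<in> S"
proof -
  obtain g where g: "geodesic_choice G S g" "(\<Union>x\<in>S. \<Union>y\<in>S - {x}. set (g x y)) = pverts G"
    using assms(1) unfolding strong_geodetic_set_def by (elim conjE exE) (rule that)
  have "v \<in> pverts G" using assms(2) by (simp add: simplicial_def)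
  then have "v \<in> (\<Union>x\<in>S. \<Union>y\<in>S - {x}. set (g x y))" using g(2) by simp
  then obtain x y where xy: "x \<in> S" "y \<in> S" "x \<noteq> y" "v \<in> set (g x y)" by blast
  then have "geodesic G x y (g x y)" using g(1) unfolding geodesic_choice_def by blast
  then show ?thesis using simplicial_on_geodesic[OF _ assms(2) xy(4)] xy by blast
qed

text \<open>
  This is how strong geodetic sets are produced below: every vertex outside \<open>S\<close> reserves, for itself
  alone, a pair of non-adjacent vertices of \<open>S\<close> of which it is a common neighbour. No pair is
  reserved twice, so the geodesics of the reserved pairs can be chosen independently; the geodesics
  of the other pairs are arbitrary.
\<close>

lemma strong_geodetic_set_by_reserved_pairs:
  assumes G: "pair_graph G" "strongly_connected (with_proj G)"
    and S: "S \<subseteq> pverts G" "1 < card S"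
    and pq: "\<And>v. v \<in> pverts G - S \<Longrightarrow> p v \<in> S \<and> q v \<in> S \<and> p v \<noteq> q v \<and>
      (p v, q v) \<notin> parcs G \<and> (p v, v) \<in> parcs G \<and> (v, q v) \<in> parcs G"
    and inj: "inj_on (\<lambda>v. {p v, q v}) (pverts G - S)"
  shows "strong_geodetic_set G S"
proof -
  let ?good = "\<lambda>e d. geodesic G (hd d) (last d) d \<and> e = {hd d, last d} \<and>
    (\<forall>v\<in>pverts G - S. {p v, q v} = e \<longrightarrow> v \<in> set d)"
  have "\<exists>d. ?good {x, y} d" if xy: "x \<in> S" "y \<in> S" "x \<noteq> y" for x y
  proof (cases "\<exists>v\<in>pverts G - S. {p v, q v} = {x, y}")
    case True
    then obtain v where v: "v \<in> pverts G - S" "{p v, q v} = {x, y}" by blast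
    then have "w = v" if "w \<in> pverts G - S" "{p w, q w} = {x, y}" for w
      using inj_onD[OF inj, of w v] that v by simp
    moreover have "geodesic G (p v) (q v) [p v, v, q v]"
      using geodesic_through_common_neighbour[OF G(1)] pq[OF v(1)] by blast
    ultimately show ?thesis using v(2) by (intro exI[of _ "[p v, v, q v]"]) auto
  next
    case False
    obtain d where d: "geodesic G x y d" using geodesic_exists[OF G] xy S by blast
    then have "hd d = x" "last d = y" by (auto simp: geodesic_def)
    then show ?thesis using False d by (intro exI[of _ d]) auto
  qed
  note ex_good = this
  define D where "D e = (SOME d. ?good e d)" for e
  \<comment> \<open>\<open>D\<close> orients the geodesic of a pair arbitrarily; reversing it when needed makes \<open>g\<close> symmetric.\<close>
  define g where "g x y = (if hd (D {x, y}) = x then D {x, y} else rev (D {x, y}))" for x y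
  have good: "?good {x, y} (D {x, y})" if "x \<in> S" "y \<in> S" "x \<noteq> y" for x y
    unfolding D_def by (rule someI_ex) (rule ex_good[OF that])
  have g_geo: "geodesic G x y (g x y) \<and> g y x = rev (g x y)" if xy: "x \<in> S" "y \<in> S" "x \<noteq> y" for x y
  proof -
    let ?d = "D {x, y}"
    have geo: "geodesic G (hd ?d) (last ?d) ?d" and ends: "{x, y} = {hd ?d, last ?d}"
      using good[OF xy] by auto
    have comm: "D {y, x} = ?d" by (simp add: insert_commute)
    from ends consider "hd ?d = x" "last ?d = y" | "hd ?d = y" "last ?d = x"
      by (auto simp: doubleton_eq_iff)
    then show ?thesis
      using geo geodesic_rev[OF G(1) geo] xy(3) by cases (auto simp: g_def comm)
  qed
  have set_g: "set (g x y) = set (D {x, y})" for x y by (simp add: g_def)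
  have choice: "geodesic_choice G S g" using g_geo unfolding geodesic_choice_def by blast
  have on: "x \<in> set (g x y) \<and> set (g x y) \<subseteq> pverts G" if "x \<in> S" "y \<in> S" "x \<noteq> y" for x y
    using g_geo[OF that] hd_in_set[of "g x y"] by (simp add: geodesic_def vpath_def vwalk_def)
  have "\<exists>x\<in>S. \<exists>y\<in>S - {x}. v \<in> set (g x y)" if v: "v \<in> pverts G" for v
  proof (cases "v \<in> S")
    case True
    moreover have "\<not> S \<subseteq> {v}" using S(2) card_mono[of "{v}" S] by auto
    ultimately show ?thesis using on by blast
  next
    case False
    then have *: "p v \<in> S" "q v \<in> S" "p v \<noteq> q v" using pq v by blast+
    then have "v \<in> set (g (p v) (q v))" using good[OF *] v False set_g by auto
    then show ?thesis
      using * by (intro bexI[where P = "\<lambda>x. \<exists>y\<in>S - {x}. v \<in> set (g x y)" and x = "p v"] bexI[of _ "q v"]) auto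
  qed
  then have "(\<Union>x\<in>S. \<Union>y\<in>S - {x}. set (g x y)) = pverts G" using on by fast
  then show ?thesis
    unfolding strong_geodetic_set_def using S(1) choice by (intro conjI exI[of _ g])
qed

lemma sg_eqI:
  assumes "strong_geodetic_set G S" "\<And>T. strong_geodetic_set G T \<Longrightarrow> card S \<le> card T"
  shows "sg G = card S"
  unfolding sg_def using assms by (intro Least_equality) auto

section \<open>The nested faces of an Apollonian network\<close>

text \<open>
  Numbering from the empty triangle rather than from \<open>A(0)\<close>: the inner faces of \<open>stage k\<close> are those that
  receive the leaves of \<open>A(k)\<close>, so \<open>A(k)\<close> is \<open>stage (Suc k)\<close>.
\<close>

definition stage :: "nat \<Rightarrow> plane_triangulation" where
  "stage n = (fill_inner_faces ^^ n) base_triangle"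

definition outer_face :: face where
  "outer_face = (CornerA, CornerB, CornerC)"

primrec descendants :: "nat \<Rightarrow> face \<Rightarrow> face set" where
  "descendants 0 f = {f}"
| "descendants (Suc n) f = (\<Union>g\<in>descendants n f. subfaces g)"

lemma descendants_add: "descendants (m + n) f = (\<Union>g\<in>descendants m f. descendants n g)"
  by (induction n) auto

text \<open>The first entry of a subface is the centre of its parent, and a centre names its face.\<close>

lemma subfaces_unique_parent: "f \<in> subfaces g \<Longrightarrow> f \<in> subfaces h \<Longrightarrow> g = h"
  by (cases g; cases h) auto

lemma descendants_unique_ancestor: "f \<in> descendants n g \<Longrightarrow> f \<in> descendants n h \<Longrightarrow> g = h"
  by (induction n arbitrary: f) (auto dest: subfaces_unique_parent)

lemma descendant_with_corner: "v \<in> corners f \<Longrightarrow> \<exists>g\<in>descendants n f. v \<in> corners g"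
proof (induction n)
  case (Suc n)
  then obtain g where g: "g \<in> descendants n f" "v \<in> corners g" by blast
  then have "\<exists>h\<in>subfaces g. v \<in> corners h" by (cases g) auto
  then show ?case using g by auto
qed simp

text \<open>
  Two faces \<open>p\<close>, \<open>q\<close> of the same level that descend from different siblings \<open>g\<close>, \<open>g'\<close> have the parent of
  these siblings as their smallest common ancestor. So they determine the siblings.
\<close>

lemma siblings_determined_by_descendants:
  assumes "g \<in> subfaces h" "g' \<in> subfaces h" "g \<noteq> g'" "p \<in> descendants m g" "q \<in> descendants m g'"
    and "f \<in> subfaces i" "f' \<in> subfaces i" "f \<noteq> f'" "p \<in> descendants n f" "q \<in> descendants n f'"
  shows "g = f \<and> g' = f'"
proof -
  \<comment> \<open>If \<open>m < n\<close>, the parent \<open>h\<close> would lie below both \<open>f\<close> and \<open>f'\<close>.\<close>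
  have not_less: False
    if "m < n" "g \<in> subfaces h" "g' \<in> subfaces h" "p \<in> descendants m g" "q \<in> descendants m g'"
      "f \<noteq> f'" "p \<in> descendants n f" "q \<in> descendants n f'"
    for g g' h f f' m n
  proof -
    obtain r where n: "n = r + (1 + m)" using \<open>m < n\<close> by (metis add.commute less_natE plus_1_eq_Suc add_Suc_right)
    have h: "p \<in> descendants (1 + m) h" "q \<in> descendants (1 + m) h"
      unfolding descendants_add using that by auto
    have "h \<in> descendants r f" "h \<in> descendants r f'"
      using that(7,8) h descendants_unique_ancestor
      unfolding n descendants_add[of r] by blast+
    then show False using descendants_unique_ancestor \<open>f \<noteq> f'\<close> by blast
  qed
  consider "m = n" | "m < n" | "n < m" by linarith
  then show ?thesis
    using assms descendants_unique_ancestor not_less[of m n g h g' f f'] not_less[of n m f i f' g g']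
    by cases blast+
qed

lemma apollonian_stage: "apollonian r = tri_graph (stage (Suc r))"
  and stage_Suc: "stage (Suc n) = fill_inner_faces (stage n)"
proof -
  have "apollonian_plane r = stage (Suc r)"
    by (induction r) (simp_all add: stage_def)
  then show "apollonian r = tri_graph (stage (Suc r))" by (simp add: apollonian_def)
qed (simp add: stage_def)

lemma good_stage: "good_triangulation n (stage n)"
  by (induction n) (simp_all add: stage_def good_triangle good_fill)

lemma inner_faces_stage: "inner_faces (stage n) = descendants n outer_face"
  by (induction n) (simp_all add: stage_def base_triangle_def outer_face_def fill_inner_faces_def)

lemma pverts_stage:
  "pverts (tri_graph (stage n)) = corners outer_face \<union> (\<Union>i<n. centre ` descendants i outer_face)"
proof (induction n)
  case 0
  then show ?case by (simp add: stage_def base_triangle_def outer_face_def)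
next
  case (Suc n)
  have "pverts (tri_graph (stage (Suc n))) = pverts (tri_graph (stage n)) \<union> centre ` descendants n outer_face"
    by (simp add: stage_Suc fill_inner_faces_def inner_faces_stage[symmetric])
  then show ?case by (simp add: Suc.IH lessThan_Suc Un_commute Un_left_commute)
qed

lemma parcs_stage_Suc:
  "parcs (tri_graph (stage (Suc n))) = parcs (tri_graph (stage n))
     \<union> {(centre f, u) | f u. f \<in> inner_faces (stage n) \<and> u \<in> corners f}
     \<union> {(u, centre f) | f u. f \<in> inner_faces (stage n) \<and> u \<in> corners f}"
  by (simp add: stage_Suc fill_inner_faces_def)

lemma inner_faces_are_triangles:
  "f \<in> inner_faces (stage n) \<Longrightarrow> u \<in> corners f \<Longrightarrow> w \<in> corners f \<Longrightarrow> u \<noteq> w \<Longrightarrow>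
     (u, w) \<in> parcs (tri_graph (stage n))"
proof (induction n arbitrary: f u w)
  case 0
  then show ?case by (auto simp: stage_def base_triangle_def)
next
  case (Suc n)
  let ?T = "stage n"
  obtain g where g: "g \<in> inner_faces ?T" "f \<in> subfaces g"
    using Suc.prems(1) by (auto simp: stage_Suc fill_inner_faces_def)
  then have "corners f \<subseteq> insert (centre g) (corners g)" by (cases g) auto
  then consider "u \<in> corners g" "w \<in> corners g" | "u = centre g" "w \<in> corners g"
    | "u \<in> corners g" "w = centre g"
    using Suc.prems(2-4) by blast
  then show ?case
    unfolding parcs_stage_Suc using Suc.IH[OF g(1)] g(1) Suc.prems(4) by cases blast+
qed

lemma corners_of_leaf: "f \<in> descendants k outer_face \<Longrightarrow> corners f \<subseteq> pverts (tri_graph (stage k))"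
  and leaf_fresh: "f \<in> descendants k outer_face \<Longrightarrow> centre f \<notin> pverts (tri_graph (stage k))"
proof -
  assume f: "f \<in> descendants k outer_face"
  note good = good_stage[of k, unfolded good_triangulation_def inner_faces_stage]
  show "corners f \<subseteq> pverts (tri_graph (stage k))" using good f by blast
  have "depth (centre f) = Suc k" using good f by blast
  moreover have "\<forall>v\<in>pverts (tri_graph (stage k)). depth v \<le> k" using good by blast
  ultimately show "centre f \<notin> pverts (tri_graph (stage k))" by auto
qed

text \<open>
  A leaf is fresh at the last filling, so that all its arcs were added for its own face.
\<close>

lemma arcs_at_leaf:
  assumes "f \<in> descendants k outer_face"
  shows "(centre f, u) \<in> parcs (apollonian k) \<longleftrightarrow> u \<in> corners f"
    and "(u, centre f) \<in> parcs (apollonian k) \<longleftrightarrow> u \<in> corners f"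
proof -
  let ?T = "stage k"
  interpret pair_graph "tri_graph ?T" using good_stage[of k] by (simp add: good_triangulation_def)
  have f: "f \<in> inner_faces ?T" using assms by (simp add: inner_faces_stage)
  have fresh: "centre f \<notin> pverts (tri_graph ?T)"
    using leaf_fresh[OF assms] .
  have corner: "corners g \<subseteq> pverts (tri_graph ?T)" if "g \<in> inner_faces ?T" for g
    using corners_of_leaf that by (simp add: inner_faces_stage)
  have old: "(centre f, u) \<notin> parcs (tri_graph ?T)" "(u, centre f) \<notin> parcs (tri_graph ?T)"
    using fresh in_arcsD1 in_arcsD2 by blast+
  note arcs = apollonian_stage parcs_stage_Suc
  show "(centre f, u) \<in> parcs (apollonian k) \<longleftrightarrow> u \<in> corners f"
    unfolding arcs using old f fresh corner injD[OF inj_centre] by blast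
  show "(u, centre f) \<in> parcs (apollonian k) \<longleftrightarrow> u \<in> corners f"
    unfolding arcs using old f fresh corner injD[OF inj_centre] by blast
qed

abbreviation leaves :: "nat \<Rightarrow> apollonian_vertex set" where
  "leaves k \<equiv> centre ` descendants k outer_face"

lemma card_leaves: "card (leaves k) = 3 ^ k"
  using good_stage[of k] card_image[OF inj_on_subset[OF inj_centre subset_UNIV]]
  by (simp add: good_triangulation_def inner_faces_stage)

lemma leaves_simplicial:
  assumes "v \<in> leaves k"
  shows "simplicial (apollonian k) v"
proof -
  obtain f where f: "f \<in> descendants k outer_face" "v = centre f" using assms by blast
  have "(u, w) \<in> parcs (apollonian k)" if "u \<in> corners f" "w \<in> corners f" "u \<noteq> w" for u w
    using inner_faces_are_triangles[of f k u w] that f(1)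
    by (simp add: inner_faces_stage apollonian_stage parcs_stage_Suc)
  moreover have "v \<in> pverts (apollonian k)"
    using f by (auto simp: apollonian_stage pverts_stage)
  ultimately show ?thesis using f arcs_at_leaf[OF f(1)] by (simp add: simplicial_def)
qed

lemma leaves_nonadjacent:
  assumes "v \<in> leaves k" "w \<in> leaves k"
  shows "(v, w) \<notin> parcs (apollonian k)"
proof -
  obtain f where f: "f \<in> descendants k outer_face" "v = centre f" using assms by blast
  have "w \<notin> pverts (tri_graph (stage k))" "corners f \<subseteq> pverts (tri_graph (stage k))"
    using assms(2) f(1) leaf_fresh corners_of_leaf by blast+
  then show ?thesis using arcs_at_leaf(1)[OF f(1)] f by blast
qed

lemma finite_apollonian: "finite (pverts (apollonian k))"
proof -
  interpret pair_graph "apollonian k" by (rule pair_graph_apollonian)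
  show ?thesis by (rule pair_finite_verts)
qed

lemma finite_strong_geodetic_set:
  assumes "strong_geodetic_set (apollonian k) S"
  shows "finite S"
proof -
  have "S \<subseteq> pverts (apollonian k)"
    using assms unfolding strong_geodetic_set_def by (elim conjE)
  then show ?thesis using finite_apollonian by (rule finite_subset)
qed

section \<open>Strong geodetic sets from sibling faces\<close>

text \<open>
  The form in which the argument covers both \<open>k \<ge> 2\<close>, with \<open>S\<close> the set of leaves, and \<open>k = 1\<close>, where \<open>S\<close>
  has one more vertex. The condition \<open>i < k\<close> says that the siblings \<open>a v\<close>, \<open>b v\<close> are at most as deep as the
  faces of the leaves.
\<close>

lemma strong_geodetic_set_by_sibling_faces:
  assumes S: "leaves k \<subseteq> S" "S \<subseteq> pverts (apollonian k)"
    and sib: "\<And>v. v \<in> pverts (apollonian k) - S \<Longrightarrow> \<exists>i<k. \<exists>h\<in>descendants i outer_face.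
      a v \<in> subfaces h \<and> b v \<in> subfaces h \<and> a v \<noteq> b v \<and> v \<in> corners (a v) \<and> v \<in> corners (b v)"
    and inj: "inj_on (\<lambda>v. {a v, b v}) (pverts (apollonian k) - S)"
    and k: "0 < k"
  shows "strong_geodetic_set (apollonian k) S"
proof -
  let ?G = "apollonian k"
  let ?R = "\<lambda>v p q. p \<in> descendants k outer_face \<and> q \<in> descendants k outer_face \<and>
    v \<in> corners p \<and> v \<in> corners q \<and>
    (\<exists>m h. a v \<in> subfaces h \<and> b v \<in> subfaces h \<and> a v \<noteq> b v \<and> p \<in> descendants m (a v) \<and> q \<in> descendants m (b v))"
  have "\<exists>p q. ?R v p q" if v: "v \<in> pverts ?G - S" for v
  proof -
    obtain i h where h: "i < k" "h \<in> descendants i outer_face" "a v \<in> subfaces h" "b v \<in> subfaces h"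
      "a v \<noteq> b v" "v \<in> corners (a v)" "v \<in> corners (b v)"
      using sib[OF v] by blast
    define m where "m = k - Suc i"
    have k: "k = Suc i + m" using h(1) by (simp add: m_def)
    obtain p q where pq: "p \<in> descendants m (a v)" "v \<in> corners p" "q \<in> descendants m (b v)" "v \<in> corners q"
      using descendant_with_corner h(6,7) by blast
    moreover have "p \<in> descendants k outer_face" "q \<in> descendants k outer_face"
      unfolding k descendants_add using pq h by auto
    ultimately show ?thesis using h by blast
  qed
  then obtain p q where R: "\<And>v. v \<in> pverts ?G - S \<Longrightarrow> ?R v (p v) (q v)" by metis
  have neq: "p v \<noteq> q v" if "v \<in> pverts ?G - S" for v
    using R[OF that] by (metis descendants_unique_ancestor)
  have inj_p: "inj_on (\<lambda>v. {centre (p v), centre (q v)}) (pverts ?G - S)"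
  proof (rule inj_onI)
    fix v w assume v: "v \<in> pverts ?G - S" and w: "w \<in> pverts ?G - S"
      and eq: "{centre (p v), centre (q v)} = {centre (p w), centre (q w)}"
    then have "p v = p w \<and> q v = q w \<or> p v = q w \<and> q v = p w"
      by (auto simp: doubleton_eq_iff dest: injD[OF inj_centre])
    then have "{a v, b v} = {a w, b w}"
    proof
      assume "p v = p w \<and> q v = q w"
      then have "a v = a w \<and> b v = b w"
        using R[OF v] R[OF w] siblings_determined_by_descendants by metis
      then show ?thesis by simp
    next
      assume "p v = q w \<and> q v = p w"
      then have "a v = b w \<and> b v = a w"
        using R[OF v] R[OF w] siblings_determined_by_descendants by metis
      then show ?thesis by auto
    qed
    then show "v = w" using inj_onD[OF inj, of v w] v w by simp
  qed
  have "finite S" using S(2) finite_apollonian by (rule finite_subset)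
  then have "3 ^ k \<le> card S" using card_mono[OF _ S(1)] card_leaves by simp
  moreover have "1 < (3::nat) ^ k" using k by (intro one_less_power) auto
  ultimately have crd: "1 < card S" by linarith
  show ?thesis
  proof (rule strong_geodetic_set_by_reserved_pairs[OF pair_graph_apollonian connected_apollonian S(2) crd])
    show "inj_on (\<lambda>v. {(centre \<circ> p) v, (centre \<circ> q) v}) (pverts ?G - S)" using inj_p by simp
  next
    fix v assume v: "v \<in> pverts ?G - S"
    then have pq: "p v \<in> descendants k outer_face" "q v \<in> descendants k outer_face"
      "v \<in> corners (p v)" "v \<in> corners (q v)" using R by blast+
    then have "centre (p v) \<in> S" "centre (q v) \<in> S" using S(1) by auto
    moreover have "centre (p v) \<noteq> centre (q v)" using neq[OF v] injD[OF inj_centre] by blast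
    moreover have "(centre (p v), centre (q v)) \<notin> parcs ?G" using leaves_nonadjacent pq by blast
    ultimately show "(centre \<circ> p) v \<in> S \<and> (centre \<circ> q) v \<in> S \<and> (centre \<circ> p) v \<noteq> (centre \<circ> q) v \<and>
      ((centre \<circ> p) v, (centre \<circ> q) v) \<notin> parcs ?G \<and>
      ((centre \<circ> p) v, v) \<in> parcs ?G \<and> (v, (centre \<circ> q) v) \<in> parcs ?G"
      using pq arcs_at_leaf by simp
  qed
qed

abbreviation hub :: apollonian_vertex where
  "hub \<equiv> Centre CornerA CornerB CornerC"

text \<open>
  The centre of a face takes the first two of its three subfaces. In the outer triangle this is the
  pair that meets in \<open>CornerB\<close>; the other two pairs go to \<open>CornerA\<close> and \<open>CornerC\<close>. For \<open>CornerB\<close> the face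
  \<open>(hub, CornerA, CornerB)\<close> has a pair to spare: its own centre takes the subfaces at \<open>hub, CornerA\<close> and
  at \<open>CornerA, CornerB\<close>, which leaves those at \<open>CornerA, CornerB\<close> and at \<open>hub, CornerB\<close>.
\<close>

fun siblings :: "apollonian_vertex \<Rightarrow> face \<times> face" where
  "siblings CornerA = ((hub, CornerA, CornerB), (hub, CornerA, CornerC))"
| "siblings CornerC = ((hub, CornerB, CornerC), (hub, CornerA, CornerC))"
| "siblings CornerB =
    ((Centre hub CornerA CornerB, CornerA, CornerB), (Centre hub CornerA CornerB, hub, CornerB))"
| "siblings (Centre x y z) = ((Centre x y z, x, y), (Centre x y z, y, z))"

lemma inj_siblings: "inj (\<lambda>v. {fst (siblings v), snd (siblings v)})"
proof (rule injI)
  fix v w assume "{fst (siblings v), snd (siblings v)} = {fst (siblings w), snd (siblings w)}"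
  then show "v = w" by (cases v; cases w) (auto simp: doubleton_eq_iff)
qed

lemma leaves_strong_geodetic:
  assumes "2 \<le> k"
  shows "strong_geodetic_set (apollonian k) (leaves k)"
proof (rule strong_geodetic_set_by_sibling_faces[where a = "fst \<circ> siblings" and b = "snd \<circ> siblings"])
  show "leaves k \<subseteq> pverts (apollonian k)" by (auto simp: apollonian_stage pverts_stage)
  show "inj_on (\<lambda>v. {(fst \<circ> siblings) v, (snd \<circ> siblings) v}) (pverts (apollonian k) - leaves k)"
    using inj_siblings by (auto intro: inj_on_subset)
next
  fix v assume v: "v \<in> pverts (apollonian k) - leaves k"
  then consider "v = CornerA" | "v = CornerB" | "v = CornerC"
    | i h where "i < k" "h \<in> descendants i outer_face" "v = centre h"
  proof -
    have "v \<in> corners outer_face \<union> (\<Union>i<k. centre ` descendants i outer_face)"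
      using v unfolding apollonian_stage pverts_stage lessThan_Suc by blast
    moreover have "corners outer_face = {CornerA, CornerB, CornerC}" by (simp add: outer_face_def)
    ultimately show thesis using that by blast
  qed
  then show "\<exists>i<k. \<exists>h\<in>descendants i outer_face.
      (fst \<circ> siblings) v \<in> subfaces h \<and> (snd \<circ> siblings) v \<in> subfaces h \<and>
      (fst \<circ> siblings) v \<noteq> (snd \<circ> siblings) v \<and>
      v \<in> corners ((fst \<circ> siblings) v) \<and> v \<in> corners ((snd \<circ> siblings) v)"
  proof cases
    case 1
    then show ?thesis using assms
      by (intro exI[of _ 0] conjI bexI[of _ outer_face]) (auto simp: outer_face_def)
  next
    case 2
    then show ?thesis using assms
      by (intro exI[of _ 1] conjI bexI[of _ "(hub, CornerA, CornerB)"]) (auto simp: outer_face_def)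
  next
    case 3
    then show ?thesis using assms
      by (intro exI[of _ 0] conjI bexI[of _ outer_face]) (auto simp: outer_face_def)
  next
    case (4 i h)
    have "good_triangulation i (stage i)" by (rule good_stage)
    then have "case h of (x, y, z) \<Rightarrow> x \<noteq> y \<and> y \<noteq> z \<and> x \<noteq> z"
      using 4(2) unfolding good_triangulation_def inner_faces_stage by blast
    then show ?thesis using 4
      by (intro exI[of _ i] conjI bexI[of _ h]) (cases h; auto)+
  qed
qed (use assms in auto)

section \<open>The strong geodetic numbers\<close>

lemma sg_apollonian_0: "sg (apollonian 0) = 4"
proof -
  let ?G = "apollonian 0"
  let ?V = "{CornerA, CornerB, CornerC, hub}"
  have V: "pverts ?G = ?V"
    by (auto simp: apollonian_stage pverts_stage outer_face_def)
  have adj: "(u, w) \<in> parcs ?G" if "u \<in> ?V" "w \<in> ?V" "u \<noteq> w" for u w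
    using that by (auto simp: apollonian_def fill_inner_faces_def base_triangle_def)
  have crd: "card ?V = 4" by simp
  have "strong_geodetic_set ?G ?V"
    by (rule strong_geodetic_set_by_reserved_pairs[OF pair_graph_apollonian connected_apollonian,
          where p = id and q = id]) (simp_all add: V)
  moreover have "card ?V \<le> card T" if T: "strong_geodetic_set ?G T" for T
  proof -
    interpret pair_graph ?G by (rule pair_graph_apollonian)
    have "simplicial ?G v" if "v \<in> ?V" for v
      unfolding simplicial_def
    proof (intro conjI allI impI)
      fix u w assume "(u, v) \<in> parcs ?G \<and> (v, w) \<in> parcs ?G \<and> u \<noteq> w"
      then show "(u, w) \<in> parcs ?G"
        using adj in_arcsD1[of u v] in_arcsD2[of v w] unfolding V by blast
    qed (use that V in simp)
    then have "?V \<subseteq> T" using simplicial_in_strong_geodetic_set[OF T] by blast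
    then show ?thesis using finite_strong_geodetic_set[OF T] card_mono by blast
  qed
  ultimately have "sg ?G = card ?V" by (rule sg_eqI)
  then show ?thesis using crd by simp
qed

text \<open>
  In \<open>A(1)\<close> the three leaves do not suffice: they are pairwise at distance two, so their three geodesics
  cover at most three of the remaining four vertices.
\<close>

lemma sg_apollonian_1: "sg (apollonian 1) = 4"
proof -
  let ?G = "apollonian 1"
  define x y z where "x = Centre hub CornerA CornerB" and "y = Centre hub CornerB CornerC"
    and "z = Centre hub CornerA CornerC"
  note xyz = x_def y_def z_def
  have D: "descendants 1 outer_face = {(hub, CornerA, CornerB), (hub, CornerB, CornerC), (hub, CornerA, CornerC)}"
    by (auto simp: outer_face_def)
  have L: "leaves 1 = {x, y, z}" unfolding D by (simp add: xyz)
  have V: "pverts ?G = {CornerA, CornerB, CornerC, hub, x, y, z}"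
    unfolding apollonian_stage pverts_stage
    using D by (auto simp: xyz outer_face_def less_Suc_eq)
  have dist: "distinct [CornerA, CornerB, CornerC, hub, x, y, z]" by (simp add: xyz)
  \<comment> \<open>With \<open>hub\<close> in the set, the pair of subfaces meeting in \<open>CornerB\<close> is free for \<open>CornerB\<close>.\<close>
  let ?S = "{hub, x, y, z}"
  define a b where "a = (\<lambda>v. if v = CornerC then (hub, CornerB, CornerC) else (hub, CornerA, CornerB))"
    and "b = (\<lambda>v. if v = CornerB then (hub, CornerB, CornerC) else (hub, CornerA, CornerC))"
  have rest: "pverts ?G - ?S = {CornerA, CornerB, CornerC}" unfolding V using dist by auto
  have "strong_geodetic_set ?G ?S"
  proof (rule strong_geodetic_set_by_sibling_faces[where a = a and b = b])
    show "inj_on (\<lambda>v. {a v, b v}) (pverts ?G - ?S)"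
      unfolding rest by (auto simp: inj_on_def a_def b_def doubleton_eq_iff)
  next
    fix v assume "v \<in> pverts ?G - ?S"
    then show "\<exists>i<1. \<exists>h\<in>descendants i outer_face.
      a v \<in> subfaces h \<and> b v \<in> subfaces h \<and> a v \<noteq> b v \<and> v \<in> corners (a v) \<and> v \<in> corners (b v)"
      unfolding rest by (auto simp: a_def b_def outer_face_def)
  qed (use L V in auto)
  moreover have "card ?S \<le> card T" if T: "strong_geodetic_set ?G T" for T
  proof (rule ccontr)
    assume "\<not> card ?S \<le> card T"
    then have small: "card T \<le> 3" using dist by simp
    have sub: "{x, y, z} \<subseteq> T"
      using simplicial_in_strong_geodetic_set[OF T] leaves_simplicial[of _ 1] L by blast
    have three: "card {x, y, z} = 3" using dist by simp
    have TL: "T = {x, y, z}"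
      using card_seteq[OF finite_strong_geodetic_set[OF T] sub] small three by simp
    obtain g where g: "geodesic_choice ?G T g" "(\<Union>s\<in>T. \<Union>t\<in>T - {s}. set (g s t)) = pverts ?G"
      using T unfolding strong_geodetic_set_def by (elim conjE exE) (rule that)
    \<comment> \<open>\<open>hub\<close> is a common neighbour of all leaves, so their geodesics have length two.\<close>
    have hub: "(s, hub) \<in> parcs ?G \<and> (hub, s) \<in> parcs ?G" if s: "s \<in> T" for s
    proof -
      obtain f where f: "f \<in> descendants 1 outer_face" "s = centre f"
        using s unfolding TL L[symmetric] by blast
      have "hub \<in> corners f" using f(1) unfolding D by auto
      then show ?thesis using arcs_at_leaf[OF f(1)] f(2) by blast
    qed
    have mid: "\<exists>m. set (g s t) \<subseteq> {s, m, t}" if "s \<in> T" "t \<in> T" "s \<noteq> t" for s t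
    proof -
      have "geodesic ?G s t (g s t)" using g(1) that unfolding geodesic_choice_def by blast
      then show ?thesis
        by (rule geodesic_length_two[OF pair_graph_apollonian]) (use hub that in blast)+
    qed
    have rev: "set (g t s) = set (g s t)" if "s \<in> T" "t \<in> T" "s \<noteq> t" for s t
      using g(1) that unfolding geodesic_choice_def by (metis set_rev)
    have ne: "x \<noteq> y" "y \<noteq> z" "x \<noteq> z" and inT: "x \<in> T" "y \<in> T" "z \<in> T"
      using dist TL by auto
    obtain m1 m2 m3 where m: "set (g x y) \<subseteq> {x, m1, y}" "set (g y z) \<subseteq> {y, m2, z}"
      "set (g x z) \<subseteq> {x, m3, z}"
      using mid ne inT by meson
    have "(\<Union>s\<in>T. \<Union>t\<in>T - {s}. set (g s t)) \<subseteq> set (g x y) \<union> set (g y z) \<union> set (g x z)"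
      using rev[of x y] rev[of y z] rev[of x z] ne inT by (auto simp: TL)
    then have "pverts ?G \<subseteq> set [x, y, z, m1, m2, m3]" using m g(2) by auto
    then have "card (pverts ?G) \<le> card (set [x, y, z, m1, m2, m3])" by (intro card_mono) auto
    also have "\<dots> \<le> 6" using card_length[of "[x, y, z, m1, m2, m3]"] by simp
    finally show False using V distinct_card[OF dist] by simp
  qed
  ultimately have "sg ?G = card ?S" by (rule sg_eqI)
  then show ?thesis using dist by simp
qed

lemma sg_apollonian_ge_2:
  assumes "2 \<le> k"
  shows "sg (apollonian k) = 3 ^ k"
proof -
  have "card (leaves k) \<le> card T" if T: "strong_geodetic_set (apollonian k) T" for T
    using simplicial_in_strong_geodetic_set[OF T] leaves_simplicial finite_strong_geodetic_set[OF T]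
    by (intro card_mono) auto
  then show ?thesis
    using sg_eqI[OF leaves_strong_geodetic[OF assms]] card_leaves by simp
qed

theorem theorem2p4:
  shows "sg (apollonian 0) = 4 \<and> sg (apollonian 1) = 4 \<and> (\<forall>k\<ge>2. sg (apollonian k) = 3 ^ k)"
  using sg_apollonian_0 sg_apollonian_1 sg_apollonian_ge_2 by blast

end
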